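(* Let $(\mathscr C_i,C_i)_{i\in I}$ be a family of categories with bases of computability indexed by a set $I$. Then their product in $\mathsf{CatBaseComp}$ is $$\prod_{i\in I}(\mathscr C_i,C_i)=\Big(\prod_{i\in I}\mathscr C_i,\ \prod_{i\in I}C_i\Big),\qquad\text{where}\qquad\Big(\prod_{i\in I}C_i\Big)\big((c_i)_{i\in I}\big)=\prod_{i\in I}C_i(c_i).$$
   Context: A base of computability $B$ in a category $\mathscr C$ is a family $(B(a))_{a\in\mathscr C_0}$, where each $B(a)$ is a subclass of the class $\mathrm{Mon}(-,a)$ of monomorphisms with codomain $a$, such that: (Base1) $1_a\in B(a)$ for every object $a$; (Base2) for all objects $a,b$, all $i\colon s\to a$ in $B(a)$, all $j\colon t\to b$ in $B(b)$, and all $f\colon s\to b$, there is a pullback of $j$ along $f$, with projection $f^*j\colon j^*(s)\to s$, such that $i\circ f^*j\in B(a)$. If $C$, $D$ are bases of computability in $\mathscr C$, $\mathscr D$, a computability transfer $F\colon(\mathscr C,C)\to(\mathscr D,D)$ is a functor $F\colon\mathscr C\to\mathscr D$ such that $F(i)\in D(F(a))$ for all objects $a$ and all $i\in C(a)$, and $F$ preserves all pullbacks occurring in (Base2) (i.e. pullbacks of arrows $j\in C(b)$ along arbitrary arrows $f\colon s\to b$). $\mathsf{CatBaseComp}$ is the 2-category with objects the categories with a base of computability, 1-cells the computability transfers, and 2-cells the natural transformations between underlying functors. Products are 2-categorical: a product $\prod_iA_i$ is an ordinary product of the underlying 1-category such that moreover, for 1-cells $f,g\colon A\to\prod_iA_i$,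 2-cells $f\Rightarrow g$ correspond bijectively (by whiskering with the projections) to families of 2-cells $\mathrm{pr}_i\circ f\Rightarrow\mathrm{pr}_i\circ g$. *)

theory Defs
  imports "HOL-Library.FuncSet"
begin

section \<open>Categories, functors, natural transformations\<close>

text \<open>\<open>Comp C g f\<close> is the composite \<open>g \<circ> f\<close>. The operations are total HOL functions; their
  values matter only on objects, on arrows and on composable pairs.\<close>

record ('o, 'm) cat =
  Obj :: "'o set"
  Arr :: "'m set"
  Dom :: "'m \<Rightarrow> 'o"
  Cod :: "'m \<Rightarrow> 'o"
  Ident :: "'o \<Rightarrow> 'm"
  Comp :: "'m \<Rightarrow> 'm \<Rightarrow> 'm"

definition hom :: "('o, 'm) cat \<Rightarrow> 'o \<Rightarrow> 'o \<Rightarrow> 'm set" where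
  "hom C a b = {f \<in> Arr C. Dom C f = a \<and> Cod C f = b}"

locale category =
  fixes C :: "('o, 'm) cat"
  assumes Dom_in: "f \<in> Arr C \<Longrightarrow> Dom C f \<in> Obj C"
    and Cod_in: "f \<in> Arr C \<Longrightarrow> Cod C f \<in> Obj C"
    and Ident_in: "a \<in> Obj C \<Longrightarrow> Ident C a \<in> hom C a a"
    and Comp_in: "f \<in> hom C a b \<Longrightarrow> g \<in> hom C b c \<Longrightarrow> Comp C g f \<in> hom C a c"
    and Comp_Ident: "f \<in> hom C a b \<Longrightarrow> Comp C f (Ident C a) = f"
    and Ident_Comp: "f \<in> hom C a b \<Longrightarrow> Comp C (Ident C b) f = f"
    and Comp_assoc: "f \<in> hom C a b \<Longrightarrow> g \<in> hom C b c \<Longrightarrow> h \<in> hom C c d \<Longrightarrow>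
      Comp C h (Comp C g f) = Comp C (Comp C h g) f"

text \<open>Functors and natural transformations are required to be \<^const>\<open>extensional\<close>, so that
  HOL equality is equality of functors and of natural transformations.\<close>

record ('o, 'm, 'p, 'n) func =
  onObj :: "'o \<Rightarrow> 'p"
  onArr :: "'m \<Rightarrow> 'n"

locale is_functor = source: category C + target: category D
  for C :: "('o, 'm) cat" and D :: "('p, 'n) cat" +
  fixes F :: "('o, 'm, 'p, 'n) func"
  assumes onObj_in: "onObj F \<in> Obj C \<rightarrow>\<^sub>E Obj D"
    and onArr_ext: "onArr F \<in> extensional (Arr C)"
    and onArr_in: "f \<in> hom C a b \<Longrightarrow> onArr F f \<in> hom D (onObj F a) (onObj F b)"
    and onArr_Ident: "a \<in> Obj C \<Longrightarrow> onArr F (Ident C a) = Ident D (onObj F a)"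
    and onArr_Comp: "f \<in> hom C a b \<Longrightarrow> g \<in> hom C b c \<Longrightarrow>
      onArr F (Comp C g f) = Comp D (onArr F g) (onArr F f)"

definition func_comp ::
  "('o, 'm) cat \<Rightarrow> ('p, 'n, 'q, 'r) func \<Rightarrow> ('o, 'm, 'p, 'n) func \<Rightarrow> ('o, 'm, 'q, 'r) func" where
  "func_comp C G F =
    \<lparr>onObj = compose (Obj C) (onObj G) (onObj F), onArr = compose (Arr C) (onArr G) (onArr F)\<rparr>"

definition nat_trans ::
  "('o, 'm) cat \<Rightarrow> ('p, 'n) cat \<Rightarrow> ('o, 'm, 'p, 'n) func \<Rightarrow> ('o, 'm, 'p, 'n) func \<Rightarrow>
    ('o \<Rightarrow> 'n) set" where
  "nat_trans C D F G =
    {\<alpha> \<in> \<Pi>\<^sub>E a\<in>Obj C. hom D (onObj F a) (onObj G a).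
      \<forall>a b. \<forall>f\<in>hom C a b. Comp D (\<alpha> b) (onArr F f) = Comp D (onArr G f) (\<alpha> a)}"

definition whisker :: "('o, 'm) cat \<Rightarrow> ('p, 'n, 'q, 'r) func \<Rightarrow> ('o \<Rightarrow> 'n) \<Rightarrow> 'o \<Rightarrow> 'r" where
  "whisker C H \<alpha> = (\<lambda>a\<in>Obj C. onArr H (\<alpha> a))"


section \<open>Bases of computability\<close>

definition Mon :: "('o, 'm) cat \<Rightarrow> 'o \<Rightarrow> 'm set" where
  "Mon C a = {i \<in> Arr C. Cod C i = a \<and>
    (\<forall>x. \<forall>f\<in>hom C x (Dom C i). \<forall>g\<in>hom C x (Dom C i). Comp C i f = Comp C i g \<longrightarrow> f = g)}"

text \<open>\<open>p\<close> and \<open>q\<close> are the projections of a pullback of the cospan \<open>(f, j)\<close>, i.e. \<open>f \<circ> p = j \<circ> q\<close>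
  is a pullback square; \<open>p\<close> is the pullback of \<open>j\<close> along \<open>f\<close>.\<close>

definition is_pullback :: "('o, 'm) cat \<Rightarrow> 'm \<Rightarrow> 'm \<Rightarrow> 'm \<Rightarrow> 'm \<Rightarrow> bool" where
  "is_pullback C f j p q \<longleftrightarrow>
    (\<exists>s t b u. f \<in> hom C s b \<and> j \<in> hom C t b \<and> p \<in> hom C u s \<and> q \<in> hom C u t \<and>
      Comp C f p = Comp C j q \<and>
      (\<forall>v. \<forall>x\<in>hom C v s. \<forall>y\<in>hom C v t. Comp C f x = Comp C j y \<longrightarrow>
        (\<exists>!w. w \<in> hom C v u \<and> Comp C p w = x \<and> Comp C q w = y)))"

type_synonym ('o, 'm) cat_base = "('o, 'm) cat \<times> ('o \<Rightarrow> 'm set)"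

definition base_of_computability :: "('o, 'm) cat \<Rightarrow> ('o \<Rightarrow> 'm set) \<Rightarrow> bool" where
  "base_of_computability C B \<longleftrightarrow>
    (\<forall>a\<in>Obj C. B a \<subseteq> Mon C a) \<and>
    (\<forall>a\<in>Obj C. Ident C a \<in> B a) \<and>
    (\<forall>a\<in>Obj C. \<forall>b\<in>Obj C. \<forall>i\<in>B a. \<forall>j\<in>B b. \<forall>f\<in>hom C (Dom C i) b.
      \<exists>p q. is_pullback C f j p q \<and> Comp C i p \<in> B a)"


section \<open>The 2-category CatBaseComp and its products\<close>

text \<open>Since the product of a family of categories has a type different from that of the factors,
  CatBaseComp is represented by its type-polymorphic objects, 1-cells and 2-cells. Composition of
  1-cells is \<^const>\<open>func_comp\<close>, and the 2-cells are the elements of \<^const>\<open>nat_trans\<close>.\<close>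

definition cat_with_base :: "('o, 'm) cat_base \<Rightarrow> bool" where
  "cat_with_base X \<longleftrightarrow> category (fst X) \<and> base_of_computability (fst X) (snd X)"

definition comp_transfer ::
  "('o, 'm) cat_base \<Rightarrow> ('p, 'n) cat_base \<Rightarrow> ('o, 'm, 'p, 'n) func \<Rightarrow> bool" where
  "comp_transfer X Y F \<longleftrightarrow>
    is_functor (fst X) (fst Y) F \<and>
    (\<forall>a\<in>Obj (fst X). \<forall>i\<in>snd X a. onArr F i \<in> snd Y (onObj F a)) \<and>
    (\<forall>b\<in>Obj (fst X). \<forall>j\<in>snd X b. \<forall>f p q. is_pullback (fst X) f j p q \<longrightarrow>
      is_pullback (fst Y) (onArr F f) (onArr F j) (onArr F p) (onArr F q))"

definition two_cells ::
  "('o, 'm) cat_base \<Rightarrow> ('p, 'n) cat_base \<Rightarrow> ('o, 'm, 'p, 'n) func \<Rightarrow> ('o, 'm, 'p, 'n) func \<Rightarrow>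
    ('o \<Rightarrow> 'n) set" where
  "two_cells X Y F G = nat_trans (fst X) (fst Y) F G"

text \<open>\<open>P\<close> with projections \<open>pr i\<close> is a 2-categorical product of the \<open>X i\<close>, \<open>i \<in> I\<close>. A definition
  cannot quantify over types, so the types \<open>'x\<close>, \<open>'y\<close> of the objects and arrows of the test
  objects \<open>A\<close> are parameters; a statement polymorphic in \<open>'x\<close>, \<open>'y\<close> covers all test objects.\<close>

definition is_product ::
  "'x itself \<Rightarrow> 'y itself \<Rightarrow> 'i set \<Rightarrow> ('i \<Rightarrow> ('o, 'm) cat_base) \<Rightarrow> ('p, 'n) cat_base \<Rightarrow>
    ('i \<Rightarrow> ('p, 'n, 'o, 'm) func) \<Rightarrow> bool" where
  "is_product TX TY I X P pr \<longleftrightarrow>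
    cat_with_base P \<and> (\<forall>i\<in>I. comp_transfer P (X i) (pr i)) \<and>
    (\<forall>A :: ('x, 'y) cat_base. cat_with_base A \<longrightarrow>
      (\<forall>F. (\<forall>i\<in>I. comp_transfer A (X i) (F i)) \<longrightarrow>
        (\<exists>!G. comp_transfer A P G \<and> (\<forall>i\<in>I. func_comp (fst A) (pr i) G = F i))) \<and>
      (\<forall>f g. comp_transfer A P f \<longrightarrow> comp_transfer A P g \<longrightarrow>
        bij_betw (\<lambda>\<alpha>. \<lambda>i\<in>I. whisker (fst A) (pr i) \<alpha>)
          (two_cells A P f g)
          (\<Pi>\<^sub>E i\<in>I. two_cells A (X i) (func_comp (fst A) (pr i) f) (func_comp (fst A) (pr i) g))))"


section \<open>The product of a family of categories with bases\<close>

text \<open>The members of a family have a common object type and a common arrow type, but arbitrary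
  carriers in them; a disjoint union brings every set-indexed family into this form.\<close>

definition prod_cat :: "'i set \<Rightarrow> ('i \<Rightarrow> ('o, 'm) cat) \<Rightarrow> ('i \<Rightarrow> 'o, 'i \<Rightarrow> 'm) cat" where
  "prod_cat I C =
    \<lparr>Obj = (\<Pi>\<^sub>E i\<in>I. Obj (C i)),
     Arr = (\<Pi>\<^sub>E i\<in>I. Arr (C i)),
     Dom = (\<lambda>f. \<lambda>i\<in>I. Dom (C i) (f i)),
     Cod = (\<lambda>f. \<lambda>i\<in>I. Cod (C i) (f i)),
     Ident = (\<lambda>a. \<lambda>i\<in>I. Ident (C i) (a i)),
     Comp = (\<lambda>g f. \<lambda>i\<in>I. Comp (C i) (g i) (f i))\<rparr>"

definition prod_base :: "'i set \<Rightarrow> ('i \<Rightarrow> 'o \<Rightarrow> 'm set) \<Rightarrow> ('i \<Rightarrow> 'o) \<Rightarrow> ('i \<Rightarrow> 'm) set" where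
  "prod_base I B c = (\<Pi>\<^sub>E i\<in>I. B i (c i))"

definition prod_proj ::
  "'i set \<Rightarrow> ('i \<Rightarrow> ('o, 'm) cat) \<Rightarrow> 'i \<Rightarrow> ('i \<Rightarrow> 'o, 'i \<Rightarrow> 'm, 'o, 'm) func" where
  "prod_proj I C i =
    \<lparr>onObj = (\<lambda>a\<in>Obj (prod_cat I C). a i), onArr = (\<lambda>f\<in>Arr (prod_cat I C). f i)\<rparr>"

end

theory Submission
  imports Defs
begin

text \<open>
  Everything in a product category is computed componentwise; the one place where this needs an
  argument is pullbacks. Projections have to preserve pullbacks, and they need not have left
  adjoints, since the other factors may lack initial objects. But a square that is already a pullback
  in the product supplies, in every other factor, the commutative square of its own components. A
  cone over the \<open>i\<close>-th component therefore extends to a cone over the whole square, and the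
  mediating arrow of the latter has the wanted \<open>i\<close>-th component. Hence (\<open>is_pullback_prod_cat\<close>) a
  square is a pullback in the product iff all its components are pullbacks.

  From components to the product, this equivalence gives (Base2), once a pullback is chosen in each
  factor, and shows that a tuple of computability transfers preserves the required pullbacks; from
  the product to its components, it shows that the projections are computability transfers. The
  bijections on 1-cells and 2-cells are the tupling bijections for functions into a product set;
  since functors, natural transformations and families are all extensional, the two composites are
  identities on the nose.
\<close>

section \<open>The product category\<close>

lemma (in category) in_hom:
  assumes "f \<in> hom C a b"
  shows "a \<in> Obj C" "b \<in> Obj C" "f \<in> Arr C"
  using assms Dom_in Cod_in by (auto simp: hom_def)

lemma prod_cat_simps [simp]:
  "Obj (prod_cat I C) = (\<Pi>\<^sub>E i\<in>I. Obj (C i))"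
  "Arr (prod_cat I C) = (\<Pi>\<^sub>E i\<in>I. Arr (C i))"
  "Dom (prod_cat I C) f = (\<lambda>i\<in>I. Dom (C i) (f i))"
  "Cod (prod_cat I C) f = (\<lambda>i\<in>I. Cod (C i) (f i))"
  "Ident (prod_cat I C) a = (\<lambda>i\<in>I. Ident (C i) (a i))"
  "Comp (prod_cat I C) g f = (\<lambda>i\<in>I. Comp (C i) (g i) (f i))"
  by (simp_all add: prod_cat_def)

lemma restrict_eq_iff:
  "restrict f I = g \<longleftrightarrow> g \<in> extensional I \<and> (\<forall>i\<in>I. f i = g i)"
  by (auto simp: extensional_def restrict_def fun_eq_iff)

lemma hom_prod_cat:
  "f \<in> hom (prod_cat I C) a b \<longleftrightarrow>
    a \<in> extensional I \<and> b \<in> extensional I \<and> f \<in> (\<Pi>\<^sub>E i\<in>I. hom (C i) (a i) (b i))"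
  by (auto simp: hom_def restrict_eq_iff PiE_iff)

lemma hom_prod_catD:
  assumes "f \<in> hom (prod_cat I C) a b" "i \<in> I"
  shows "f i \<in> hom (C i) (a i) (b i)"
  using assms by (auto simp: hom_prod_cat)

lemma prod_cat_eqI:
  assumes "f \<in> hom (prod_cat I C) a b" "g \<in> hom (prod_cat I C) a b" "\<And>i. i \<in> I \<Longrightarrow> f i = g i"
  shows "f = g"
  using assms unfolding hom_prod_cat by (blast intro: PiE_ext)

lemma category_prod_cat:
  assumes cat: "\<And>i. i \<in> I \<Longrightarrow> category (C i)"
  shows "category (prod_cat I C)"
proof
  show "Dom (prod_cat I C) f \<in> Obj (prod_cat I C)" "Cod (prod_cat I C) f \<in> Obj (prod_cat I C)"
    if "f \<in> Arr (prod_cat I C)" for f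
    using that by (auto intro!: category.Dom_in category.Cod_in cat)
  show ident: "Ident (prod_cat I C) a \<in> hom (prod_cat I C) a a" if "a \<in> Obj (prod_cat I C)" for a
    using that by (auto simp: hom_prod_cat PiE_iff intro!: category.Ident_in cat)
  show comp: "Comp (prod_cat I C) g f \<in> hom (prod_cat I C) a c"
    if "f \<in> hom (prod_cat I C) a b" "g \<in> hom (prod_cat I C) b c" for f g a b c
    using that by (auto simp: hom_prod_cat PiE_iff intro!: category.Comp_in cat)
  show "Comp (prod_cat I C) f (Ident (prod_cat I C) a) = f"
    "Comp (prod_cat I C) (Ident (prod_cat I C) b) f = f"
    if "f \<in> hom (prod_cat I C) a b" for f a b
    using that category.Comp_Ident[OF cat] category.Ident_Comp[OF cat]
    by (auto simp: hom_prod_cat PiE_iff restrict_eq_iff)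
  show "Comp (prod_cat I C) h (Comp (prod_cat I C) g f)
      = Comp (prod_cat I C) (Comp (prod_cat I C) h g) f"
    if "f \<in> hom (prod_cat I C) a b" "g \<in> hom (prod_cat I C) b c" "h \<in> hom (prod_cat I C) c d"
    for f g h a b c d
  proof -
    have "Comp (C i) (h i) (Comp (C i) (g i) (f i)) = Comp (C i) (Comp (C i) (h i) (g i)) (f i)"
      if i: "i \<in> I" for i
      using category.Comp_assoc[OF cat[OF i]] hom_prod_catD[OF _ i]
        \<open>f \<in> hom (prod_cat I C) a b\<close> \<open>g \<in> hom (prod_cat I C) b c\<close>
        \<open>h \<in> hom (prod_cat I C) c d\<close>
      by blast
    then show ?thesis
      by (auto intro!: restrict_ext)
  qed
qed

lemma Mon_prod_cat:
  assumes a: "a \<in> extensional I" and m: "m \<in> (\<Pi>\<^sub>E i\<in>I. Mon (C i) (a i))"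
  shows "m \<in> Mon (prod_cat I C) a"
proof -
  let ?P = "prod_cat I C"
  have "f = g"
    if fg: "f \<in> hom ?P x (Dom ?P m)" "g \<in> hom ?P x (Dom ?P m)" and eq: "Comp ?P m f = Comp ?P m g"
    for x f g
  proof (rule prod_cat_eqI[OF fg])
    fix i assume i: "i \<in> I"
    have "Comp (C i) (m i) (f i) = Comp (C i) (m i) (g i)"
      using fun_cong[OF eq, of i] i by simp
    moreover have "f i \<in> hom (C i) (x i) (Dom (C i) (m i))" "g i \<in> hom (C i) (x i) (Dom (C i) (m i))"
      using hom_prod_catD[OF fg(1) i] hom_prod_catD[OF fg(2) i] i by simp_all
    moreover have "m i \<in> Mon (C i) (a i)"
      using m i by auto
    ultimately show "f i = g i"
      unfolding Mon_def by blast
  qed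
  moreover have "m \<in> Arr ?P" "Cod ?P m = a"
    using a m by (auto simp: Mon_def restrict_eq_iff PiE_iff)
  ultimately show ?thesis
    unfolding Mon_def by blast
qed


section \<open>Pullbacks in a product category\<close>

lemma is_pullback_in_Arr:
  assumes "is_pullback C f j p q"
  shows "f \<in> Arr C" "j \<in> Arr C" "p \<in> Arr C" "q \<in> Arr C"
  using assms by (auto simp: is_pullback_def hom_def)

text \<open>The four corners of a square are determined by its sides, so the existential
  quantifiers in the definition of a pullback can be instantiated by any known corners.\<close>

lemma is_pullback_iff:
  assumes "f \<in> hom C s b" "j \<in> hom C t b" "p \<in> hom C u s" "q \<in> hom C u t"
  shows "is_pullback C f j p q \<longleftrightarrow> Comp C f p = Comp C j q \<and>
    (\<forall>v. \<forall>x\<in>hom C v s. \<forall>y\<in>hom C v t. Comp C f x = Comp C j y \<longrightarrow>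
      (\<exists>!w. w \<in> hom C v u \<and> Comp C p w = x \<and> Comp C q w = y))" (is "_ \<longleftrightarrow> ?R")
proof
  assume "is_pullback C f j p q"
  then obtain s' t' b' u' where
    sides: "f \<in> hom C s' b'" "j \<in> hom C t' b'" "p \<in> hom C u' s'" "q \<in> hom C u' t'" and
    R': "Comp C f p = Comp C j q \<and>
      (\<forall>v. \<forall>x\<in>hom C v s'. \<forall>y\<in>hom C v t'. Comp C f x = Comp C j y \<longrightarrow>
        (\<exists>!w. w \<in> hom C v u' \<and> Comp C p w = x \<and> Comp C q w = y))"
    unfolding is_pullback_def by blast
  have "s' = s" "t' = t" "u' = u"
    using sides assms by (auto simp: hom_def)
  with R' show ?R
    by simp
qed (use assms in \<open>unfold is_pullback_def, blast\<close>)

text \<open>Each implication turns a cone in one setting into a cone in the other. From the product to a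
  factor, the cone is completed in the other factors by the projections \<open>p\<close> and \<open>q\<close> themselves;
  a competing mediating arrow in the factor then competes, after replacing one component, with
  the mediating arrow in the product.\<close>

lemma is_pullback_prod_cat:
  assumes arr: "f \<in> Arr (prod_cat I C)" "j \<in> Arr (prod_cat I C)"
    "p \<in> Arr (prod_cat I C)" "q \<in> Arr (prod_cat I C)"
  shows "is_pullback (prod_cat I C) f j p q \<longleftrightarrow> (\<forall>i\<in>I. is_pullback (C i) (f i) (j i) (p i) (q i))"
    (is "is_pullback ?P _ _ _ _ \<longleftrightarrow> _")
proof (intro iffI ballI)
  fix i assume pb: "is_pullback ?P f j p q" and i: "i \<in> I"
  then obtain s t b u where
    sides: "f \<in> hom ?P s b" "j \<in> hom ?P t b" "p \<in> hom ?P u s" "q \<in> hom ?P u t"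
    unfolding is_pullback_def by blast
  have comm: "Comp ?P f p = Comp ?P j q"
    and univ: "\<And>v x y. x \<in> hom ?P v s \<Longrightarrow> y \<in> hom ?P v t \<Longrightarrow> Comp ?P f x = Comp ?P j y \<Longrightarrow>
        \<exists>!w. w \<in> hom ?P v u \<and> Comp ?P p w = x \<and> Comp ?P q w = y"
    using pb unfolding is_pullback_iff[OF sides] by blast+
  have commI: "Comp (C k) (f k) (p k) = Comp (C k) (j k) (q k)" if "k \<in> I" for k
    using fun_cong[OF comm, of k] that by simp
  show "is_pullback (C i) (f i) (j i) (p i) (q i)"
    unfolding is_pullback_iff[OF hom_prod_catD[OF sides(1) i] hom_prod_catD[OF sides(2) i]
      hom_prod_catD[OF sides(3) i] hom_prod_catD[OF sides(4) i]]
  proof (intro conjI allI ballI impI)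
    fix v x y
    assume x: "x \<in> hom (C i) v (s i)" and y: "y \<in> hom (C i) v (t i)"
      and xy: "Comp (C i) (f i) x = Comp (C i) (j i) y"
    have "p(i := x) \<in> hom ?P (u(i := v)) s" "q(i := y) \<in> hom ?P (u(i := v)) t"
      using sides(3,4) x y i by (auto simp: hom_prod_cat PiE_iff extensional_def)
    moreover have "Comp ?P f (p(i := x)) = Comp ?P j (q(i := y))"
      using xy commI by (auto intro!: restrict_ext)
    ultimately obtain w where w: "w \<in> hom ?P (u(i := v)) u"
      "Comp ?P p w = p(i := x)" "Comp ?P q w = q(i := y)"
      and w_unique: "\<And>w'. w' \<in> hom ?P (u(i := v)) u \<Longrightarrow> Comp ?P p w' = p(i := x) \<Longrightarrow>
        Comp ?P q w' = q(i := y) \<Longrightarrow> w' = w"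
      using univ by (metis (no_types, lifting))
    show "\<exists>!w. w \<in> hom (C i) v (u i) \<and> Comp (C i) (p i) w = x \<and> Comp (C i) (q i) w = y"
    proof (rule ex1I[of _ "w i"])
      show "w i \<in> hom (C i) v (u i) \<and> Comp (C i) (p i) (w i) = x \<and> Comp (C i) (q i) (w i) = y"
        using hom_prod_catD[OF w(1) i] fun_cong[OF w(2), of i] fun_cong[OF w(3), of i] i by simp
    next
      fix w' assume w': "w' \<in> hom (C i) v (u i) \<and> Comp (C i) (p i) w' = x \<and> Comp (C i) (q i) w' = y"
      have "w(i := w') = w"
      proof (rule w_unique)
        show "w(i := w') \<in> hom ?P (u(i := v)) u"
          using w(1) w' i by (auto simp: hom_prod_cat PiE_iff extensional_def)
        show "Comp ?P p (w(i := w')) = p(i := x)" "Comp ?P q (w(i := w')) = q(i := y)"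
          using w(2,3) w' by (auto simp: restrict_eq_iff)
      qed
      then show "w' = w i"
        by (metis fun_upd_same)
    qed
  qed (rule commI[OF i])
next
  assume pb: "\<forall>i\<in>I. is_pullback (C i) (f i) (j i) (p i) (q i)"
  define s t b u where "s = Dom ?P f" and "t = Dom ?P j" and "b = Cod ?P f" and "u = Dom ?P p"
  have sides_i: "f i \<in> hom (C i) (s i) (b i)" "j i \<in> hom (C i) (t i) (b i)"
    "p i \<in> hom (C i) (u i) (s i)" "q i \<in> hom (C i) (u i) (t i)" if "i \<in> I" for i
    using pb that unfolding is_pullback_def s_def t_def b_def u_def by (auto simp: hom_def)
  have sides: "f \<in> hom ?P s b" "j \<in> hom ?P t b" "p \<in> hom ?P u s" "q \<in> hom ?P u t"
    using arr sides_i unfolding hom_prod_cat by (auto simp: PiE_iff s_def t_def b_def u_def)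
  have comm: "Comp (C i) (f i) (p i) = Comp (C i) (j i) (q i)"
    and univ: "\<And>v x y. x \<in> hom (C i) v (s i) \<Longrightarrow> y \<in> hom (C i) v (t i) \<Longrightarrow>
        Comp (C i) (f i) x = Comp (C i) (j i) y \<Longrightarrow>
        \<exists>!w. w \<in> hom (C i) v (u i) \<and> Comp (C i) (p i) w = x \<and> Comp (C i) (q i) w = y"
    if "i \<in> I" for i
    using pb[rule_format, OF that] unfolding is_pullback_iff[OF sides_i[OF that]] by blast+
  show "is_pullback ?P f j p q"
    unfolding is_pullback_iff[OF sides]
  proof (intro conjI allI ballI impI)
    show "Comp ?P f p = Comp ?P j q"
      using comm by (auto intro!: restrict_ext)
  next
    fix v x y
    assume x: "x \<in> hom ?P v s" and y: "y \<in> hom ?P v t" and xy: "Comp ?P f x = Comp ?P j y"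
    have ex1: "\<exists>!w. w \<in> hom (C i) (v i) (u i) \<and> Comp (C i) (p i) w = x i \<and> Comp (C i) (q i) w = y i"
      if "i \<in> I" for i
      using univ[OF that hom_prod_catD[OF x that] hom_prod_catD[OF y that]] fun_cong[OF xy, of i] that
      by simp
    then have "\<forall>i\<in>I. \<exists>w. w \<in> hom (C i) (v i) (u i) \<and>
        Comp (C i) (p i) w = x i \<and> Comp (C i) (q i) w = y i"
      by blast
    then obtain w where w: "\<And>i. i \<in> I \<Longrightarrow> w i \<in> hom (C i) (v i) (u i) \<and>
        Comp (C i) (p i) (w i) = x i \<and> Comp (C i) (q i) (w i) = y i"
      by metis
    have ext: "v \<in> extensional I" "u \<in> extensional I" "x \<in> extensional I" "y \<in> extensional I"
      using x y sides(3) unfolding hom_prod_cat by (auto simp: PiE_iff)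
    show "\<exists>!w. w \<in> hom ?P v u \<and> Comp ?P p w = x \<and> Comp ?P q w = y"
    proof (rule ex1I[of _ "restrict w I"])
      show "restrict w I \<in> hom ?P v u \<and> Comp ?P p (restrict w I) = x \<and> Comp ?P q (restrict w I) = y"
        using w ext by (auto simp: hom_prod_cat restrict_eq_iff)
    next
      fix w' assume w': "w' \<in> hom ?P v u \<and> Comp ?P p w' = x \<and> Comp ?P q w' = y"
      then have w'_hom: "w' \<in> hom ?P v u"
        by blast
      have "w i = w' i" if "i \<in> I" for i
      proof -
        have "Comp (C i) (p i) (w' i) = x i" "Comp (C i) (q i) (w' i) = y i"
          using w' that by (auto simp: restrict_eq_iff)
        then show ?thesis
          using ex1[OF that] w[OF that] hom_prod_catD[OF w'_hom that] by blast
      qed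
      moreover have "w' \<in> extensional I"
        using w'_hom unfolding hom_prod_cat by (auto simp: PiE_iff)
      ultimately show "w' = restrict w I"
        by (auto simp: restrict_eq_iff intro!: sym[of "restrict w I"])
    qed
  qed
qed


section \<open>The product base\<close>

lemma base_in_Arr:
  assumes "base_of_computability C B" "a \<in> Obj C" "i \<in> B a"
  shows "i \<in> Arr C"
  using assms by (auto simp: base_of_computability_def Mon_def)

lemma base_of_computability_prod_base:
  assumes base: "\<And>i. i \<in> I \<Longrightarrow> base_of_computability (C i) (B i)"
  shows "base_of_computability (prod_cat I C) (prod_base I B)"
  unfolding base_of_computability_def
proof (intro conjI ballI)
  let ?P = "prod_cat I C"
  show "prod_base I B a \<subseteq> Mon ?P a" if "a \<in> Obj ?P" for a
  proof
    fix m assume m: "m \<in> prod_base I B a"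
    have "m i \<in> Mon (C i) (a i)" if i: "i \<in> I" for i
    proof -
      have "a i \<in> Obj (C i)" "m i \<in> B i (a i)"
        using \<open>a \<in> Obj ?P\<close> m i by (auto simp: prod_base_def)
      then show ?thesis
        using base[OF i] unfolding base_of_computability_def by blast
    qed
    then show "m \<in> Mon ?P a"
      using that m by (intro Mon_prod_cat) (auto simp: prod_base_def PiE_iff)
  qed
  show "Ident ?P a \<in> prod_base I B a" if "a \<in> Obj ?P" for a
    using that base by (auto simp: prod_base_def PiE_iff base_of_computability_def)
  fix a b m j f
  assume a: "a \<in> Obj ?P" and b: "b \<in> Obj ?P" and m: "m \<in> prod_base I B a"
    and j: "j \<in> prod_base I B b" and f: "f \<in> hom ?P (Dom ?P m) b"
  have "\<forall>i\<in>I. \<exists>p q. is_pullback (C i) (f i) (j i) p q \<and> Comp (C i) (m i) p \<in> B i (a i)"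
  proof
    fix i assume i: "i \<in> I"
    have "a i \<in> Obj (C i)" "b i \<in> Obj (C i)" "m i \<in> B i (a i)" "j i \<in> B i (b i)"
      using a b m j i by (auto simp: prod_base_def)
    moreover have "f i \<in> hom (C i) (Dom (C i) (m i)) (b i)"
      using hom_prod_catD[OF f i] i by simp
    ultimately show "\<exists>p q. is_pullback (C i) (f i) (j i) p q \<and> Comp (C i) (m i) p \<in> B i (a i)"
      using base[OF i] unfolding base_of_computability_def by blast
  qed
  then obtain p q where pq: "\<And>i. i \<in> I \<Longrightarrow>
      is_pullback (C i) (f i) (j i) (p i) (q i) \<and> Comp (C i) (m i) (p i) \<in> B i (a i)"
    by metis
  have "is_pullback ?P f j (restrict p I) (restrict q I)"
  proof (subst is_pullback_prod_cat)
    show "f \<in> Arr ?P"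
      using f by (simp add: hom_def)
    show "j \<in> Arr ?P"
      using j b base_in_Arr[OF base] by (fastforce simp: prod_base_def PiE_iff)
    show "restrict p I \<in> Arr ?P" "restrict q I \<in> Arr ?P"
      using pq by (auto dest: is_pullback_in_Arr)
  qed (use pq in simp)
  moreover have "Comp ?P m (restrict p I) \<in> prod_base I B a"
    using pq by (simp add: prod_base_def)
  ultimately show "\<exists>p q. is_pullback ?P f j p q \<and> Comp ?P m p \<in> prod_base I B a"
    by blast
qed

lemma cat_with_base_prod:
  assumes "\<And>i. i \<in> I \<Longrightarrow> cat_with_base (C i, B i)"
  shows "cat_with_base (prod_cat I C, prod_base I B)"
  using assms category_prod_cat[of I C] base_of_computability_prod_base[of I C B]
  by (simp add: cat_with_base_def)


section \<open>Projections and tupling of computability transfers\<close>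

lemma is_functor_prod_proj:
  assumes cat: "\<And>i. i \<in> I \<Longrightarrow> category (C i)" and i: "i \<in> I"
  shows "is_functor (prod_cat I C) (C i) (prod_proj I C i)"
proof -
  let ?P = "prod_cat I C"
  interpret P: category ?P
    using cat by (rule category_prod_cat)
  interpret Ci: category "C i"
    using cat i .
  have arr: "onArr (prod_proj I C i) f = f i" if "f \<in> hom ?P a b" for f a b
    using that by (simp add: prod_proj_def hom_def)
  show ?thesis
  proof
    show "onObj (prod_proj I C i) \<in> Obj ?P \<rightarrow>\<^sub>E Obj (C i)"
      using i by (auto simp: prod_proj_def)
    show "onArr (prod_proj I C i) \<in> extensional (Arr ?P)"
      by (simp add: prod_proj_def)
    show "onArr (prod_proj I C i) f
        \<in> hom (C i) (onObj (prod_proj I C i) a) (onObj (prod_proj I C i) b)"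
      if f: "f \<in> hom ?P a b" for f a b
    proof -
      have "a \<in> Obj ?P" "b \<in> Obj ?P"
        using P.in_hom[OF f] by simp_all
      then show ?thesis
        using hom_prod_catD[OF f i] unfolding arr[OF f] by (simp add: prod_proj_def)
    qed
    show "onArr (prod_proj I C i) (Ident ?P a) = Ident (C i) (onObj (prod_proj I C i) a)"
      if "a \<in> Obj ?P" for a
      using arr[OF P.Ident_in[OF that]] that i by (simp add: prod_proj_def)
    show "onArr (prod_proj I C i) (Comp ?P g f)
        = Comp (C i) (onArr (prod_proj I C i) g) (onArr (prod_proj I C i) f)"
      if "f \<in> hom ?P a b" "g \<in> hom ?P b c" for f g a b c
      using arr[OF P.Comp_in[OF that]] arr[OF that(1)] arr[OF that(2)] i by simp
  qed
qed

lemma comp_transfer_prod_proj: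
  assumes X: "\<And>i. i \<in> I \<Longrightarrow> cat_with_base (C i, B i)" and i: "i \<in> I"
  shows "comp_transfer (prod_cat I C, prod_base I B) (C i, B i) (prod_proj I C i)"
proof -
  have cat: "\<And>i. i \<in> I \<Longrightarrow> category (C i)" and base: "\<And>i. i \<in> I \<Longrightarrow> base_of_computability (C i) (B i)"
    using X by (simp_all add: cat_with_base_def)
  have prod_base: "base_of_computability (prod_cat I C) (prod_base I B)"
    using base by (rule base_of_computability_prod_base)
  have "onArr (prod_proj I C i) m \<in> B i (onObj (prod_proj I C i) a)"
    if a: "a \<in> Obj (prod_cat I C)" and m: "m \<in> prod_base I B a" for a m
  proof -
    have "m \<in> Arr (prod_cat I C)"
      using base_in_Arr[of _ "prod_base I B"] prod_base a m by blast
    then show ?thesis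
      using a m i by (auto simp: prod_proj_def prod_base_def)
  qed
  moreover have "is_pullback (C i) (onArr (prod_proj I C i) f) (onArr (prod_proj I C i) j)
      (onArr (prod_proj I C i) p) (onArr (prod_proj I C i) q)"
    if pb: "is_pullback (prod_cat I C) f j p q" for f j p q
    using is_pullback_in_Arr[OF pb] pb is_pullback_prod_cat[OF is_pullback_in_Arr[OF pb]] i
    by (simp add: prod_proj_def)
  ultimately show ?thesis
    using is_functor_prod_proj[OF cat i] unfolding comp_transfer_def by simp
qed

definition tuple_func ::
  "('x, 'y) cat \<Rightarrow> 'i set \<Rightarrow> ('i \<Rightarrow> ('x, 'y, 'o, 'm) func) \<Rightarrow> ('x, 'y, 'i \<Rightarrow> 'o, 'i \<Rightarrow> 'm) func" where
  "tuple_func A I F =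
    \<lparr>onObj = (\<lambda>a\<in>Obj A. \<lambda>i\<in>I. onObj (F i) a), onArr = (\<lambda>f\<in>Arr A. \<lambda>i\<in>I. onArr (F i) f)\<rparr>"

lemma is_functor_tuple_func:
  assumes A: "category A" and cat: "\<And>i. i \<in> I \<Longrightarrow> category (C i)"
    and F: "\<And>i. i \<in> I \<Longrightarrow> is_functor A (C i) (F i)"
  shows "is_functor A (prod_cat I C) (tuple_func A I F)"
proof -
  interpret A: category A
    by (fact A)
  interpret P: category "prod_cat I C"
    using cat by (rule category_prod_cat)
  have arr: "onArr (tuple_func A I F) f = (\<lambda>i\<in>I. onArr (F i) f)" if "f \<in> hom A a b" for f a b
    using that by (simp add: tuple_func_def hom_def)
  have obj: "onObj (tuple_func A I F) a = (\<lambda>i\<in>I. onObj (F i) a)" if "a \<in> Obj A" for a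
    using that by (simp add: tuple_func_def)
  show ?thesis
  proof
    show "onObj (tuple_func A I F) \<in> Obj A \<rightarrow>\<^sub>E Obj (prod_cat I C)"
      using is_functor.onObj_in[OF F] by (fastforce simp: tuple_func_def PiE_iff)
    show "onArr (tuple_func A I F) \<in> extensional (Arr A)"
      by (simp add: tuple_func_def)
    show "onArr (tuple_func A I F) f
        \<in> hom (prod_cat I C) (onObj (tuple_func A I F) a) (onObj (tuple_func A I F) b)"
      if f: "f \<in> hom A a b" for f a b
    proof -
      have "a \<in> Obj A" "b \<in> Obj A"
        using A.in_hom[OF f] by simp_all
      then show ?thesis
        using is_functor.onArr_in[OF F f] by (simp add: arr[OF f] obj hom_prod_cat)
    qed
    show "onArr (tuple_func A I F) (Ident A a)
        = Ident (prod_cat I C) (onObj (tuple_func A I F) a)" if "a \<in> Obj A" for a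
      using arr[OF A.Ident_in[OF that]] obj[OF that] is_functor.onArr_Ident[OF F] that
      by (auto intro!: restrict_ext)
    show "onArr (tuple_func A I F) (Comp A g f)
        = Comp (prod_cat I C) (onArr (tuple_func A I F) g) (onArr (tuple_func A I F) f)"
      if "f \<in> hom A a b" "g \<in> hom A b c" for f g a b c
      using arr[OF A.Comp_in[OF that]] arr[OF that(1)] arr[OF that(2)]
        is_functor.onArr_Comp[OF F] that
      by (auto intro!: restrict_ext)
  qed
qed

lemma comp_transfer_tuple_func:
  assumes A: "cat_with_base A" and X: "\<And>i. i \<in> I \<Longrightarrow> cat_with_base (C i, B i)"
    and F: "\<And>i. i \<in> I \<Longrightarrow> comp_transfer A (C i, B i) (F i)"
  shows "comp_transfer A (prod_cat I C, prod_base I B) (tuple_func (fst A) I F)"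
proof -
  let ?T = "tuple_func (fst A) I F"
  have func: "is_functor (fst A) (prod_cat I C) ?T"
    using A X F by (intro is_functor_tuple_func) (auto simp: cat_with_base_def comp_transfer_def)
  have arr: "onArr ?T f = (\<lambda>i\<in>I. onArr (F i) f)" if "f \<in> Arr (fst A)" for f
    using that by (simp add: tuple_func_def)
  have arr_in: "onArr ?T f \<in> Arr (prod_cat I C)" if "f \<in> Arr (fst A)" for f
    using is_functor.onArr_in[OF func, of f] that unfolding hom_def by blast
  have "onArr ?T m \<in> prod_base I B (onObj ?T a)" if a: "a \<in> Obj (fst A)" and m: "m \<in> snd A a" for a m
  proof -
    have "m \<in> Arr (fst A)"
      using base_in_Arr[of "fst A" "snd A"] a m A by (simp add: cat_with_base_def)
    then show ?thesis
      using F a m by (simp add: tuple_func_def prod_base_def comp_transfer_def)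
  qed
  moreover have "is_pullback (prod_cat I C) (onArr ?T f) (onArr ?T j) (onArr ?T p) (onArr ?T q)"
    if b: "b \<in> Obj (fst A)" and j: "j \<in> snd A b" and pb: "is_pullback (fst A) f j p q" for b f j p q
  proof -
    note in_Arr = is_pullback_in_Arr[OF pb]
    have "is_pullback (C i) (onArr (F i) f) (onArr (F i) j) (onArr (F i) p) (onArr (F i) q)"
      if "i \<in> I" for i
      using F[OF that] b j pb unfolding comp_transfer_def by auto
    then show ?thesis
      using is_pullback_prod_cat[OF in_Arr[THEN arr_in]] by (simp add: arr in_Arr)
  qed
  ultimately show ?thesis
    using func unfolding comp_transfer_def by auto
qed

lemma prod_proj_comp_apply:
  assumes "is_functor A (prod_cat I C) G"
  shows "a \<in> Obj A \<Longrightarrow> onObj (func_comp A (prod_proj I C i) G) a = onObj G a i"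
    and "f \<in> Arr A \<Longrightarrow> onArr (func_comp A (prod_proj I C i) G) f = onArr G f i"
proof -
  interpret G: is_functor A "prod_cat I C" G
    by fact
  show "onObj (func_comp A (prod_proj I C i) G) a = onObj G a i" if "a \<in> Obj A"
    using PiE_mem[OF G.onObj_in that] that by (simp add: func_comp_def prod_proj_def compose_def)
  have "onArr G f \<in> Arr (prod_cat I C)" if "f \<in> Arr A"
    using G.onArr_in[of f] that unfolding hom_def by blast
  then show "onArr (func_comp A (prod_proj I C i) G) f = onArr G f i" if "f \<in> Arr A"
    using that by (simp add: func_comp_def prod_proj_def compose_def)
qed

lemma func_eqI:
  assumes "is_functor A D F" "is_functor A E G"
    and "\<And>a. a \<in> Obj A \<Longrightarrow> onObj F a = onObj G a"
    and "\<And>f. f \<in> Arr A \<Longrightarrow> onArr F f = onArr G f"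
  shows "F = G"
proof -
  have "onObj F = onObj G"
    using is_functor.onObj_in[OF assms(1)] is_functor.onObj_in[OF assms(2)] assms(3)
    by (intro extensionalityI[of _ "Obj A"]) (auto simp: PiE_iff)
  moreover have "onArr F = onArr G"
    using assms is_functor.onArr_ext by (intro extensionalityI[of _ "Arr A"]) blast+
  ultimately show ?thesis
    by simp
qed

lemma prod_proj_comp_tuple_func:
  assumes func: "is_functor A (prod_cat I C) (tuple_func A I F)"
    and F: "is_functor A D (F i)" and i: "i \<in> I"
  shows "func_comp A (prod_proj I C i) (tuple_func A I F) = F i"
proof -
  have "onObj (func_comp A (prod_proj I C i) (tuple_func A I F)) = onObj (F i)"
    using is_functor.onObj_in[OF F] prod_proj_comp_apply(1)[OF func] i
    by (intro extensionalityI[of _ "Obj A"])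
      (auto simp: PiE_iff tuple_func_def func_comp_def)
  moreover have "onArr (func_comp A (prod_proj I C i) (tuple_func A I F)) = onArr (F i)"
    using is_functor.onArr_ext[OF F] prod_proj_comp_apply(2)[OF func] i
    by (intro extensionalityI[of _ "Arr A"])
      (auto simp: tuple_func_def func_comp_def)
  ultimately show ?thesis
    by simp
qed

lemma functor_into_prod_cat_eqI:
  assumes G: "is_functor A (prod_cat I C) G" and H: "is_functor A (prod_cat I C) H"
    and eq: "\<And>i. i \<in> I \<Longrightarrow>
      func_comp A (prod_proj I C i) G = func_comp A (prod_proj I C i) H"
  shows "G = H"
proof (rule func_eqI[OF G H])
  fix a assume a: "a \<in> Obj A"
  have "onObj G a i = onObj H a i" if "i \<in> I" for i
    using prod_proj_comp_apply(1)[OF G a, of i] prod_proj_comp_apply(1)[OF H a, of i] eq[OF that]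
    by simp
  moreover have "onObj G a \<in> Obj (prod_cat I C)" "onObj H a \<in> Obj (prod_cat I C)"
    using is_functor.onObj_in[OF G] is_functor.onObj_in[OF H] a by auto
  ultimately show "onObj G a = onObj H a"
    unfolding prod_cat_simps by (blast intro: PiE_ext)
next
  fix f assume f: "f \<in> Arr A"
  have "onArr G f i = onArr H f i" if "i \<in> I" for i
    using prod_proj_comp_apply(2)[OF G f, of i] prod_proj_comp_apply(2)[OF H f, of i] eq[OF that]
    by simp
  moreover have "onArr G f \<in> Arr (prod_cat I C)" "onArr H f \<in> Arr (prod_cat I C)"
    using is_functor.onArr_in[OF G, of f] is_functor.onArr_in[OF H, of f] f
    unfolding hom_def by blast+
  ultimately show "onArr G f = onArr H f"
    unfolding prod_cat_simps by (blast intro: PiE_ext)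
qed


section \<open>Natural transformations into a product category\<close>

text \<open>A family with components \<open>\<alpha> a i\<close> is natural in \<open>a\<close> for the product iff it is natural
  in \<open>a\<close> for each \<open>i\<close>, so currying the two indices the other way round is inverse to whiskering
  with the projections.\<close>

lemma bij_betw_whisker_prod_proj:
  assumes f: "is_functor A (prod_cat I C) f" and g: "is_functor A (prod_cat I C) g"
  shows "bij_betw (\<lambda>\<alpha>. \<lambda>i\<in>I. whisker A (prod_proj I C i) \<alpha>)
    (nat_trans A (prod_cat I C) f g)
    (\<Pi>\<^sub>E i\<in>I. nat_trans A (C i)
      (func_comp A (prod_proj I C i) f) (func_comp A (prod_proj I C i) g))"
    (is "bij_betw ?W ?N (\<Pi>\<^sub>E i\<in>I. ?M i)")
proof (rule bij_betw_byWitness[where f' = "\<lambda>\<beta>. \<lambda>a\<in>Obj A. \<lambda>i\<in>I. \<beta> i a"])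
  let ?P = "prod_cat I C"
  interpret f: is_functor A ?P f
    by fact
  have objE: "onObj f a \<in> extensional I" "onObj g a \<in> extensional I" if "a \<in> Obj A" for a
    using that f.onObj_in is_functor.onObj_in[OF g] by (fastforce simp: PiE_iff)+
  note in_Obj = f.source.in_hom
  note comp_apply = prod_proj_comp_apply[OF f] prod_proj_comp_apply[OF g]
  have N_hom: "\<alpha> a \<in> hom ?P (onObj f a) (onObj g a)" if "\<alpha> \<in> ?N" "a \<in> Obj A" for \<alpha> a
    using that by (auto simp: nat_trans_def)
  have W_apply: "?W \<alpha> i a = \<alpha> a i" if "\<alpha> \<in> ?N" "i \<in> I" "a \<in> Obj A" for \<alpha> i a
    using N_hom[OF that(1,3)] that(2,3) by (simp add: whisker_def prod_proj_def hom_def)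
  have M_ext: "\<beta> i \<in> extensional (Obj A)" if "\<beta> \<in> (\<Pi>\<^sub>E i\<in>I. ?M i)" "i \<in> I" for \<beta> i
    using that by (fastforce simp: nat_trans_def PiE_iff)
  have M_hom: "\<beta> i a \<in> hom (C i) (onObj f a i) (onObj g a i)"
    if "\<beta> \<in> (\<Pi>\<^sub>E i\<in>I. ?M i)" "i \<in> I" "a \<in> Obj A" for \<beta> i a
  proof -
    have "\<beta> i \<in> ?M i"
      using that by blast
    then show ?thesis
      using that(3) by (auto simp: nat_trans_def PiE_iff comp_apply)
  qed
  have M_natural: "Comp (C i) (\<beta> i b) (onArr f h i) = Comp (C i) (onArr g h i) (\<beta> i a)"
    if "\<beta> \<in> (\<Pi>\<^sub>E i\<in>I. ?M i)" "i \<in> I" "h \<in> hom A a b" for \<beta> i a b h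
  proof -
    have "\<beta> i \<in> ?M i"
      using that by blast
    then show ?thesis
      using that(3) in_Obj[OF that(3)] by (fastforce simp: nat_trans_def comp_apply(2,4))
  qed
  show "\<forall>\<alpha>\<in>?N. (\<lambda>a\<in>Obj A. \<lambda>i\<in>I. ?W \<alpha> i a) = \<alpha>"
  proof
    fix \<alpha> assume \<alpha>: "\<alpha> \<in> ?N"
    have "(\<lambda>i\<in>I. ?W \<alpha> i a) = \<alpha> a" if "a \<in> Obj A" for a
    proof -
      have "\<alpha> a \<in> extensional I"
        using N_hom[OF \<alpha> that] unfolding hom_prod_cat by (auto simp: PiE_iff)
      then show ?thesis
        unfolding restrict_eq_iff using W_apply[OF \<alpha> _ that] by blast
    qed
    moreover have "\<alpha> \<in> extensional (Obj A)"
      using \<alpha> by (auto simp: nat_trans_def PiE_iff)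
    ultimately show "(\<lambda>a\<in>Obj A. \<lambda>i\<in>I. ?W \<alpha> i a) = \<alpha>"
      unfolding restrict_eq_iff[of _ "Obj A"] by blast
  qed
  show "?W ` ?N \<subseteq> (\<Pi>\<^sub>E i\<in>I. ?M i)"
  proof (intro image_subsetI PiE_I)
    fix \<alpha> i assume \<alpha>: "\<alpha> \<in> ?N" and i: "i \<in> I"
    have "?W \<alpha> i a \<in> hom (C i) (onObj f a i) (onObj g a i)" if "a \<in> Obj A" for a
      unfolding W_apply[OF \<alpha> i that] using hom_prod_catD[OF N_hom[OF \<alpha> that] i] .
    moreover have "?W \<alpha> i \<in> extensional (Obj A)"
      using i by (simp add: whisker_def)
    moreover have "Comp (C i) (?W \<alpha> i b) (onArr f h i) = Comp (C i) (onArr g h i) (?W \<alpha> i a)"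
      if h: "h \<in> hom A a b" for a b h
    proof -
      have "Comp ?P (\<alpha> b) (onArr f h) = Comp ?P (onArr g h) (\<alpha> a)"
        using \<alpha> h by (simp add: nat_trans_def)
      from fun_cong[OF this, of i] show ?thesis
        unfolding W_apply[OF \<alpha> i in_Obj(1)[OF h]] W_apply[OF \<alpha> i in_Obj(2)[OF h]] using i by simp
    qed
    ultimately show "?W \<alpha> i \<in> ?M i"
      by (auto simp: nat_trans_def PiE_iff comp_apply in_Obj simp del: restrict_apply)
  qed simp
  show "\<forall>\<beta>\<in>(\<Pi>\<^sub>E i\<in>I. ?M i). ?W (\<lambda>a\<in>Obj A. \<lambda>i\<in>I. \<beta> i a) = \<beta>"
    and "(\<lambda>\<beta>. \<lambda>a\<in>Obj A. \<lambda>i\<in>I. \<beta> i a) ` (\<Pi>\<^sub>E i\<in>I. ?M i) \<subseteq> ?N"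
  proof -
    have in_N: "(\<lambda>a\<in>Obj A. \<lambda>i\<in>I. \<beta> i a) \<in> ?N" if \<beta>: "\<beta> \<in> (\<Pi>\<^sub>E i\<in>I. ?M i)" for \<beta>
      using M_hom[OF \<beta>] M_natural[OF \<beta>] objE
      by (auto simp: nat_trans_def hom_prod_cat in_Obj intro!: restrict_ext)
    then show "(\<lambda>\<beta>. \<lambda>a\<in>Obj A. \<lambda>i\<in>I. \<beta> i a) ` (\<Pi>\<^sub>E i\<in>I. ?M i) \<subseteq> ?N"
      by blast
    show "\<forall>\<beta>\<in>(\<Pi>\<^sub>E i\<in>I. ?M i). ?W (\<lambda>a\<in>Obj A. \<lambda>i\<in>I. \<beta> i a) = \<beta>"
    proof
      fix \<beta> assume \<beta>: "\<beta> \<in> (\<Pi>\<^sub>E i\<in>I. ?M i)"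
      let ?\<alpha> = "\<lambda>a\<in>Obj A. \<lambda>i\<in>I. \<beta> i a"
      have "whisker A (prod_proj I C i) ?\<alpha> = \<beta> i" if i: "i \<in> I" for i
      proof (rule extensionalityI[of _ "Obj A"])
        show "whisker A (prod_proj I C i) ?\<alpha> a = \<beta> i a" if "a \<in> Obj A" for a
          using W_apply[OF in_N[OF \<beta>] i that] i that by simp
      qed (simp_all add: whisker_def M_ext[OF \<beta> i])
      moreover have "\<beta> \<in> extensional I"
        using \<beta> by (auto simp: PiE_iff)
      ultimately show "?W ?\<alpha> = \<beta>"
        unfolding restrict_eq_iff[of _ I \<beta>] by blast
    qed
  qed
qed


section \<open>The universal property\<close>

theorem lemma3p5:
  fixes I :: "'i set"
    and C :: "'i \<Rightarrow> ('o, 'm) cat"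
    and B :: "'i \<Rightarrow> 'o \<Rightarrow> 'm set"
  assumes "\<And>i. i \<in> I \<Longrightarrow> cat_with_base (C i, B i)"
  shows "is_product TYPE('x) TYPE('y) I (\<lambda>i. (C i, B i))
    (prod_cat I C, prod_base I B) (prod_proj I C)"
  unfolding is_product_def
proof (intro conjI ballI allI impI)
  let ?X = "(prod_cat I C, prod_base I B)"
  show "cat_with_base ?X"
    using assms by (rule cat_with_base_prod)
  show "comp_transfer ?X (C i, B i) (prod_proj I C i)" if "i \<in> I" for i
    using assms that by (rule comp_transfer_prod_proj)
  fix A :: "('x, 'y) cat_base" assume A: "cat_with_base A"
  have func: "is_functor (fst A) (prod_cat I C) G" if "comp_transfer A ?X G" for G
    using that by (simp add: comp_transfer_def)
  show "\<exists>!G. comp_transfer A ?X G \<and> (\<forall>i\<in>I. func_comp (fst A) (prod_proj I C i) G = F i)"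
    if F: "\<forall>i\<in>I. comp_transfer A (C i, B i) (F i)" for F
  proof (rule ex1I)
    let ?T = "tuple_func (fst A) I F"
    have T: "comp_transfer A ?X ?T"
      using A assms F by (intro comp_transfer_tuple_func) auto
    have beta: "func_comp (fst A) (prod_proj I C i) ?T = F i" if "i \<in> I" for i
      using prod_proj_comp_tuple_func[OF func[OF T], of "C i" i] F that
      by (simp add: comp_transfer_def)
    show "comp_transfer A ?X ?T \<and> (\<forall>i\<in>I. func_comp (fst A) (prod_proj I C i) ?T = F i)"
      using T beta by blast
    show "G = ?T"
      if "comp_transfer A ?X G \<and> (\<forall>i\<in>I. func_comp (fst A) (prod_proj I C i) G = F i)" for G
      using that beta by (intro functor_into_prod_cat_eqI[OF func func[OF T]]) auto
  qed
  show "bij_betw (\<lambda>\<alpha>. \<lambda>i\<in>I. whisker (fst A) (prod_proj I C i) \<alpha>) (two_cells A ?X f g)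
      (\<Pi>\<^sub>E i\<in>I. two_cells A (C i, B i) (func_comp (fst A) (prod_proj I C i) f)
        (func_comp (fst A) (prod_proj I C i) g))"
    if "comp_transfer A ?X f" "comp_transfer A ?X g" for f g
    using bij_betw_whisker_prod_proj[OF func[OF that(1)] func[OF that(2)]]
    by (simp add: two_cells_def)
qed

end
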